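(* Let $\Sigma$ be a connected signed graph with Euler-genus spectrum $\mathcal S(\Sigma)$ and let $\gamma^E_M(\Sigma)=\max\mathcal S(\Sigma)$. If $k$ is an integer with $k\in\mathcal S(\Sigma)$ and $k+1\in\mathcal S(\Sigma)$, then every integer between $k$ and $\gamma^E_M(\Sigma)$ belongs to $\mathcal S(\Sigma)$; that is, $$\{k,k+1,\ldots,\gamma^E_M(\Sigma)\}\subseteq\mathcal S(\Sigma).$$
   Context: A signed graph $\Sigma=(G,\sigma)$ is a finite graph $G$ together with a map $\sigma:E(G)\to\{+1,-1\}$; it is connected if $G$ is. A cycle of $\Sigma$ is positive if it contains an even number of edges of sign $-1$, and negative otherwise. A surface is a compact (connected) 2-dimensional manifold without boundary, orientable or not. An embedding of a graph $G$ on a surface $S$ is an embedding (homeomorphism onto its image) $\rho:G\to S$ such that every component of $S-\rho(G)$ (a face) is a 2-cell. An embedding of the signed graph $\Sigma=(G,\sigma)$ is an embedding $\rho$ of $G$ on some surface $S$ such that a cycle $C$ of $\Sigma$ is positive if and only if $\rho(C)$ is orientation-preserving on $S$. (Equivalently, in the standard combinatorial encoding, an embedding is given by a rotation system of $G$ together with the edge signature $\sigma$, faces being obtained by the usual face-tracing procedure for embedding schemes.) With $f(\rho)$ the number of faces, the Euler-genus of $\rho$ is $\gamma^E(\rho)=|E(G)|-|V(G)|+2-f(\rho)$. The Euler-genus spectrum of $\Sigma$ is $\mathcal S(\Sigma)=\{\gamma^E(\rho):\rho\text{ is an embedding of }\Sigma\}$. *)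

theory Defs
  imports "Graph_Theory.Graph_Theory" "HOL-Combinatorics.Orbits"
begin

text \<open>
  A finite graph (loops and parallel edges allowed) is a finite bidirected digraph: its arcs are
  the two orientations (darts) of the edges, \<open>arev\<close> reverses a dart, and a loop also
  has two distinct darts. The sign of an edge is carried by both of its darts.
\<close>

locale signed_graph = fin_digraph G + bidirected_digraph G arev
  for G :: "('v, 'a) pre_digraph" and arev :: "'a \<Rightarrow> 'a" +
  fixes \<sigma> :: "'a \<Rightarrow> int"
  assumes sign_values: "a \<in> arcs G \<Longrightarrow> \<sigma> a \<in> {1, -1}"
    and sign_arev: "a \<in> arcs G \<Longrightarrow> \<sigma> (arev a) = \<sigma> a"

definition edges :: "('v, 'a) pre_digraph \<Rightarrow> ('a \<Rightarrow> 'a) \<Rightarrow> 'a set set" where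
  "edges G arev = (\<lambda>a. {a, arev a}) ` arcs G"

text \<open>
  A rotation system cyclically permutes the darts leaving each vertex. Since \<open>cyclic_on\<close>
  never holds for the empty set, isolated vertices are exempted.
\<close>

definition rotation_system :: "('v, 'a) pre_digraph \<Rightarrow> ('a \<Rightarrow> 'a) \<Rightarrow> bool" where
  "rotation_system G rot \<longleftrightarrow>
     rot permutes arcs G \<and>
     (\<forall>v \<in> verts G. out_arcs G v \<noteq> {} \<longrightarrow> cyclic_on rot (out_arcs G v))"

text \<open>
  Face tracing for the embedding scheme \<open>(rot, \<sigma>)\<close>. In a state \<open>(a, s)\<close> the walk is about to
  traverse the dart \<open>a\<close>, and \<open>s\<close> tells whether it currently uses the rotation (\<open>s = 1\<close>) or its
  inverse (\<open>s = -1\<close>); traversing a negative edge toggles \<open>s\<close>.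
\<close>

definition face_step ::
  "('a \<Rightarrow> 'a) \<Rightarrow> ('a \<Rightarrow> int) \<Rightarrow> ('a \<Rightarrow> 'a) \<Rightarrow> 'a \<times> int \<Rightarrow> 'a \<times> int" where
  "face_step arev \<sigma> rot = (\<lambda>(a, s).
     (if s * \<sigma> a = 1 then rot (arev a) else inv rot (arev a), s * \<sigma> a))"

text \<open>The state in which the step out of \<open>(a, s)\<close> is traversed in the opposite direction.\<close>

definition face_rev :: "('a \<Rightarrow> 'a) \<Rightarrow> ('a \<Rightarrow> int) \<Rightarrow> 'a \<times> int \<Rightarrow> 'a \<times> int" where
  "face_rev arev \<sigma> = (\<lambda>(a, s). (arev a, - (s * \<sigma> a)))"

text \<open>A facial walk and its reversal are two orbits of states that describe the same face.\<close>

definition traced_faces ::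
  "('v, 'a) pre_digraph \<Rightarrow> ('a \<Rightarrow> 'a) \<Rightarrow> ('a \<Rightarrow> int) \<Rightarrow> ('a \<Rightarrow> 'a) \<Rightarrow> ('a \<times> int) set set" where
  "traced_faces G arev \<sigma> rot =
     (\<lambda>x. orbit (face_step arev \<sigma> rot) x \<union> face_rev arev \<sigma> ` orbit (face_step arev \<sigma> rot) x) `
       (arcs G \<times> {1, -1})"

text \<open>
  An isolated vertex has no darts, so no state sees it, but it contributes one face (the complement
  of a point in the sphere).
\<close>

definition num_faces ::
  "('v, 'a) pre_digraph \<Rightarrow> ('a \<Rightarrow> 'a) \<Rightarrow> ('a \<Rightarrow> int) \<Rightarrow> ('a \<Rightarrow> 'a) \<Rightarrow> nat" where
  "num_faces G arev \<sigma> rot =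
     card (traced_faces G arev \<sigma> rot) + card {v \<in> verts G. out_arcs G v = {}}"

definition euler_genus ::
  "('v, 'a) pre_digraph \<Rightarrow> ('a \<Rightarrow> 'a) \<Rightarrow> ('a \<Rightarrow> int) \<Rightarrow> ('a \<Rightarrow> 'a) \<Rightarrow> int" where
  "euler_genus G arev \<sigma> rot =
     int (card (edges G arev)) - int (card (verts G)) + 2 - int (num_faces G arev \<sigma> rot)"

text \<open>
  An embedding of the signed graph is encoded by a rotation system used together with the given
  signature, so that a cycle preserves orientation iff it has an even number of negative edges.
\<close>

definition euler_genus_spectrum ::
  "('v, 'a) pre_digraph \<Rightarrow> ('a \<Rightarrow> 'a) \<Rightarrow> ('a \<Rightarrow> int) \<Rightarrow> int set" where
  "euler_genus_spectrum G arev \<sigma> = {euler_genus G arev \<sigma> rot | rot. rotation_system G rot}"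

definition max_euler_genus ::
  "('v, 'a) pre_digraph \<Rightarrow> ('a \<Rightarrow> 'a) \<Rightarrow> ('a \<Rightarrow> int) \<Rightarrow> int" where
  "max_euler_genus G arev \<sigma> = Max (euler_genus_spectrum G arev \<sigma>)"

end

theory Submission
  imports Defs
begin

text \<open>
  Suppose \<open>g\<close> is missing from the spectrum but is exceeded by some embedding, and fix a rotation
  system \<open>x\<close> of Euler genus below \<open>g\<close>. Interchanging two consecutive blocks in a rotation
  multiplies the face permutation by two mirror-image 3-cycles, so it changes the number of faces by
  at most two; it creates two faces only if the three corners involved lie on one face, which
  traverses them in the same direction. Let \<open>z\<close> be an embedding above \<open>g\<close> whose rotation system
  agrees with \<open>x\<close> on as many darts as possible. Any dart where they differ is repaired by a block
  swap, which must land below \<open>g\<close>. So these swaps create two faces each, and all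
  corners where \<open>z\<close> and \<open>x\<close> differ are traversed coherently by the faces of \<open>z\<close>. Then an orientation
  of the faces of \<open>z\<close> also orients the faces of \<open>x\<close>, and comparing signs of the
  face permutations on the oriented faces gives that \<open>z\<close> and \<open>x\<close> have the same parity.
  Hence all embeddings below a gap have Euler genus of one parity.
\<close>

section \<open>Counting cycles of a permutation\<close>

text \<open>Fixed points count as cycles. In all uses \<open>f\<close> maps the finite set
  \<open>S\<close> bijectively to itself; unlike for \<open>permutes\<close>, its values outside
  \<open>S\<close> are arbitrary, because a face step need not fix pairs that are not
  states.\<close>

definition num_cycles :: "('a \<Rightarrow> 'a) \<Rightarrow> 'a set \<Rightarrow> nat" where
  "num_cycles f S = card (orbit f ` S)"

text \<open>Continuing \<open>f\<close> by the identity outside \<open>S\<close> gives a true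
  permutation with the same orbits on \<open>S\<close>.\<close>

lemma bij_betw_self_in_orbit:
  assumes "finite S" "bij_betw f S S" "x \<in> S"
  shows "x \<in> orbit f x"
proof -
  let ?g = "perm_restrict f S"
  have "bij_betw ?g S S"
    using assms(2) by (rule bij_betw_cong[THEN iffD1, rotated]) (simp add: perm_restrict_simps)
  then have "?g permutes S"
    by (rule bij_imp_permutes) (simp add: perm_restrict_simps)
  then have "x \<in> orbit ?g x"
    using assms(1) by (intro permutation_self_in_orbit) (auto simp: permutation_permutes)
  moreover have "orbit f x = orbit ?g x"
    using assms(2,3) by (intro orbit_cong0[of x S]) (auto simp: perm_restrict_simps bij_betw_def)
  ultimately show ?thesis by simp
qed

lemma orbit_subset_bij_betw:
  assumes "bij_betw f S S" "x \<in> S"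
  shows "orbit f x \<subseteq> S"
proof
  fix y assume "y \<in> orbit f x"
  then show "y \<in> S" using assms by induct (auto simp: bij_betw_def)
qed

lemma orbit_eq_if_self_in:
  assumes "x \<in> orbit f x" "y \<in> orbit f x"
  shows "orbit f y = orbit f x"
  using assms by (meson orbit_swap orbit_trans subsetI subset_antisym)

lemma orbit_eq_iff_bij_betw:
  assumes "finite S" "bij_betw f S S" "x \<in> S" "y \<in> S"
  shows "orbit f y = orbit f x \<longleftrightarrow> y \<in> orbit f x"
  using bij_betw_self_in_orbit[OF assms(1,2)] assms(3,4) orbit_eq_if_self_in by metis

section \<open>Effect of one transposition on the cycles\<close>

lemma bij_betw_comp_transpose:
  assumes "bij_betw f S S" "x \<in> S" "y \<in> S"
  shows "bij_betw (f \<circ> transpose x y) S S"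
  using assms by (intro bij_betw_trans[of "transpose x y" S S]) (auto intro!: permutes_imp_bij permutes_swap_id)

lemma comp_transpose_cancel: "(f \<circ> transpose x y) \<circ> transpose x y = f"
  by (simp add: comp_assoc)

lemma orbit_comp_transpose_other:
  assumes "z \<in> orbit f z" "x \<notin> orbit f z" "y \<notin> orbit f z"
  shows "orbit (f \<circ> transpose x y) z = orbit f z"
  using assms by (intro orbit_cong) (auto simp: transpose_def)

text \<open>The new map sends \<open>y\<close> to \<open>f x\<close> and then follows the old cycle
  of \<open>x\<close>, which avoids \<open>y\<close>, until it arrives at \<open>x\<close>.\<close>

lemma orbit_comp_transpose_merge:
  assumes "finite S" "bij_betw f S S" "x \<in> S" "y \<in> S" "orbit f x \<noteq> orbit f y"
  shows "orbit (f \<circ> transpose x y) x = orbit (f \<circ> transpose x y) y"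
proof -
  let ?g = "f \<circ> transpose x y"
  have y: "y \<notin> orbit f x"
    using assms orbit_eq_iff_bij_betw by metis
  have "w \<in> orbit ?g y" if "w \<in> orbit f x" for w
    using that
  proof induct
    case base
    show ?case using orbit.base[of ?g y] by (metis comp_apply transpose_apply_second)
  next
    case (step w)
    show ?case
    proof (cases "w = x")
      case True
      then show ?thesis using orbit.base[of ?g y] by (metis comp_apply transpose_apply_second)
    next
      case False
      with step y have "?g w = f w" by (auto simp: transpose_def)
      then show ?thesis using orbit.step[OF step(2)] by metis
    qed
  qed
  then have "x \<in> orbit ?g y"
    using bij_betw_self_in_orbit[OF assms(1-3)] by blast
  then show ?thesis
    using orbit_eq_iff_bij_betw[OF assms(1) bij_betw_comp_transpose[OF assms(2-4)] assms(4,3)] by simp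
qed

text \<open>The new orbit of \<open>x\<close> runs along the stretch of the old cycle from
  \<open>f y\<close> to \<open>x\<close> and closes up there, so it misses \<open>y\<close>.\<close>

lemma orbit_comp_transpose_split:
  assumes "finite S" "bij_betw f S S" "x \<in> S" "y \<in> S" "x \<noteq> y" "orbit f x = orbit f y"
  shows "orbit (f \<circ> transpose x y) x \<noteq> orbit (f \<circ> transpose x y) y"
proof -
  let ?g = "f \<circ> transpose x y"
  \<comment> \<open>The number of steps from \<open>y\<close> to the first visit of
    \<open>x\<close>.\<close>
  define n where "n = funpow_dist1 f y x"
  have xy: "x \<in> orbit f y"
    using bij_betw_self_in_orbit[OF assms(1-3)] assms(6) by simp
  have n: "(f ^^ n) y = x" "0 < n"
    unfolding n_def using funpow_dist1_prop[OF xy] by auto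
  have least: "(f ^^ i) y \<noteq> x" if "0 < i" "i < n" for i
    using funpow_dist1_least that unfolding n_def by metis
  have no_return: "(f ^^ i) y \<noteq> y" if "0 < i" "i \<le> n" for i
  proof
    assume *: "(f ^^ i) y = y"
    have "(f ^^ n) y = (f ^^ (n - i + i)) y" using that by simp
    also have "\<dots> = (f ^^ (n - i)) y" using * by (simp only: funpow_add comp_apply)
    finally have "(f ^^ (n - i)) y = x" using n by simp
    with least[of "n - i"] that have "i = n" by force
    with * n assms(5) show False by simp
  qed
  have "\<exists>i. 0 < i \<and> i \<le> n \<and> w = (f ^^ i) y" if "w \<in> orbit ?g x" for w
    using that
  proof induct
    case base
    show ?case using n by (intro exI[of _ 1]) auto
  next
    case (step w)
    then obtain i where i: "0 < i" "i \<le> n" "w = (f ^^ i) y" by blast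
    show ?case
    proof (cases "i = n")
      case True
      with i n show ?thesis by (intro exI[of _ 1]) auto
    next
      case False
      with i least no_return have "?g w = f w" by (auto simp: transpose_def)
      with i False show ?thesis by (intro exI[of _ "Suc i"]) auto
    qed
  qed
  with no_return have "y \<notin> orbit ?g x" by metis
  moreover have "y \<in> orbit ?g y"
    using bij_betw_self_in_orbit[OF assms(1) bij_betw_comp_transpose[OF assms(2-4)] assms(4)] .
  ultimately show ?thesis by metis
qed

text \<open>Only orbits through \<open>x\<close> or \<open>y\<close> change. Either pair may
  collapse to one set, so merging and splitting are covered at once.\<close>

lemma orbits_comp_transpose:
  assumes "finite S" "bij_betw f S S" "x \<in> S" "y \<in> S"
  defines "g \<equiv> f \<circ> transpose x y"
  shows "orbit g ` S = (orbit f ` S - {orbit f x, orbit f y}) \<union> {orbit g x, orbit g y}"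
proof -
  have g: "bij_betw g S S" unfolding g_def by (rule bij_betw_comp_transpose[OF assms(2-4)])
  have f: "f = g \<circ> transpose x y" unfolding g_def by (simp only: comp_transpose_cancel)
  note self_f = bij_betw_self_in_orbit[OF assms(1,2)]
  note self_g = bij_betw_self_in_orbit[OF assms(1) g]
  note eq_f = orbit_eq_iff_bij_betw[OF assms(1,2)]
  note eq_g = orbit_eq_iff_bij_betw[OF assms(1) g]
  show ?thesis
  proof (intro equalityI subsetI)
    fix T assume "T \<in> orbit g ` S"
    then obtain z where z: "z \<in> S" "T = orbit g z" by blast
    show "T \<in> (orbit f ` S - {orbit f x, orbit f y}) \<union> {orbit g x, orbit g y}"
    proof (cases "x \<in> orbit g z \<or> y \<in> orbit g z")
      case True
      then have "orbit g z = orbit g x \<or> orbit g z = orbit g y" using z eq_g assms(3,4) by metis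
      then show ?thesis using z by blast
    next
      case False
      then have "orbit f z = orbit g z"
        unfolding f by (intro orbit_comp_transpose_other self_g z) auto
      with False z self_f[OF assms(3)] self_f[OF assms(4)] show ?thesis by blast
    qed
  next
    fix T assume "T \<in> (orbit f ` S - {orbit f x, orbit f y}) \<union> {orbit g x, orbit g y}"
    then show "T \<in> orbit g ` S"
    proof
      assume "T \<in> orbit f ` S - {orbit f x, orbit f y}"
      then obtain z where z: "z \<in> S" "T = orbit f z" "orbit f z \<noteq> orbit f x" "orbit f z \<noteq> orbit f y"
        by blast
      then have "orbit g z = orbit f z"
        unfolding g_def using eq_f[OF z(1) assms(3)] eq_f[OF z(1) assms(4)]
        by (intro orbit_comp_transpose_other self_f[OF z(1)]) auto
      then show ?thesis using z by blast
    qed (use assms(3,4) in blast)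
  qed
qed

lemma num_cycles_comp_transpose_same:
  assumes "finite S" "bij_betw f S S" "x \<in> S" "y \<in> S" "x \<noteq> y" "orbit f x = orbit f y"
  shows "num_cycles (f \<circ> transpose x y) S = num_cycles f S + 1"
proof -
  let ?g = "f \<circ> transpose x y"
  have g: "bij_betw ?g S S" by (rule bij_betw_comp_transpose[OF assms(2-4)])
  have neq: "orbit ?g x \<noteq> orbit ?g y" by (rule orbit_comp_transpose_split[OF assms])
  \<comment> \<open>A new orbit through a point \<open>v\<close> of the cut cycle cannot be one of
    the kept orbits, as these avoid \<open>v\<close>.\<close>
  have "orbit ?g v \<notin> orbit f ` S - {orbit f x}" if v: "v \<in> S" "orbit f v = orbit f x" for v
  proof
    assume "orbit ?g v \<in> orbit f ` S - {orbit f x}"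
    then obtain z where z: "z \<in> S" "orbit ?g v = orbit f z" "orbit f z \<noteq> orbit f x" by blast
    have "v \<in> orbit f z"
      using bij_betw_self_in_orbit[OF assms(1) g v(1)] by (simp only: z(2))
    then have "orbit f v = orbit f z"
      using orbit_eq_iff_bij_betw[OF assms(1,2) z(1) v(1)] by (simp only:)
    with z(3) v(2) show False by (simp only:)
  qed
  from this[OF assms(3) refl] this[OF assms(4) assms(6)[symmetric]]
  have "(orbit f ` S - {orbit f x}) \<inter> {orbit ?g x, orbit ?g y} = {}" by blast
  then have "card ((orbit f ` S - {orbit f x}) \<union> {orbit ?g x, orbit ?g y})
      = card (orbit f ` S - {orbit f x}) + card {orbit ?g x, orbit ?g y}"
    using assms(1) by (intro card_Un_disjoint finite_Diff finite_imageI) simp_all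
  moreover have "orbit ?g ` S = (orbit f ` S - {orbit f x}) \<union> {orbit ?g x, orbit ?g y}"
    unfolding orbits_comp_transpose[OF assms(1-4)] assms(6) insert_absorb2 by (rule refl)
  ultimately have "num_cycles ?g S = card (orbit f ` S - {orbit f x}) + card {orbit ?g x, orbit ?g y}"
    unfolding num_cycles_def by (simp only:)
  then have "num_cycles ?g S = card (orbit f ` S - {orbit f x}) + 2"
    using neq by simp
  moreover have "card (orbit f ` S) = card (orbit f ` S - {orbit f x}) + 1"
    using assms(1,3) card.remove[of "orbit f ` S" "orbit f x"] by simp
  ultimately show ?thesis unfolding num_cycles_def by simp
qed

text \<open>The splitting case read backwards: composing with the same transposition again restores
  \<open>f\<close>.\<close>

lemma num_cycles_comp_transpose_diff:
  assumes "finite S" "bij_betw f S S" "x \<in> S" "y \<in> S" "orbit f x \<noteq> orbit f y"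
  shows "num_cycles f S = num_cycles (f \<circ> transpose x y) S + 1"
proof -
  let ?g = "f \<circ> transpose x y"
  have "num_cycles (?g \<circ> transpose x y) S = num_cycles ?g S + 1"
  proof (rule num_cycles_comp_transpose_same[OF assms(1) bij_betw_comp_transpose[OF assms(2-4)] assms(3,4)])
    show "orbit ?g x = orbit ?g y" by (rule orbit_comp_transpose_merge[OF assms])
  qed (use assms(5) in blast)
  then show ?thesis by (simp only: comp_transpose_cancel)
qed

lemma num_cycles_comp_transpose_le:
  assumes "finite S" "bij_betw f S S" "x \<in> S" "y \<in> S"
  shows "num_cycles (f \<circ> transpose x y) S \<le> num_cycles f S + 1"
proof (cases "x = y")
  case False
  then show ?thesis
    using num_cycles_comp_transpose_same[OF assms] num_cycles_comp_transpose_diff[OF assms]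
    by (cases "orbit f x = orbit f y") linarith+
qed simp

text \<open>\<open>h\<close> carries cycles of \<open>f\<close> to cycles of \<open>g\<close>. This
  later transports a permutation of darts to one of states.\<close>

lemma num_cycles_conj:
  assumes "finite S" "bij_betw f S S" "inj_on h S" "\<And>a. a \<in> S \<Longrightarrow> g (h a) = h (f a)"
  shows "num_cycles g (h ` S) = num_cycles f S"
proof -
  have orb: "orbit g (h a) = h ` orbit f a" if "a \<in> S" for a
  proof -
    have "orbit f a \<subseteq> S" by (rule orbit_subset_bij_betw[OF assms(2) that])
    with assms(4) show ?thesis
      using orbit_inverse[OF bij_betw_self_in_orbit[OF assms(1,2) that], of g h] by blast
  qed
  have "orbit g ` h ` S = (`) h ` orbit f ` S"
    unfolding image_image using orb by (intro image_cong) auto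
  moreover have "inj_on ((`) h) (orbit f ` S)"
  proof (rule inj_onI)
    fix A B assume "A \<in> orbit f ` S" "B \<in> orbit f ` S" "h ` A = h ` B"
    moreover from this have "A \<subseteq> S" "B \<subseteq> S" using orbit_subset_bij_betw[OF assms(2)] by auto
    ultimately show "A = B" using assms(3) inj_on_image_eq_iff by metis
  qed
  ultimately show ?thesis unfolding num_cycles_def by (simp add: card_image)
qed

lemma num_cycles_cong:
  assumes "bij_betw f S S" "\<And>a. a \<in> S \<Longrightarrow> g a = f a"
  shows "num_cycles g S = num_cycles f S"
proof -
  have "orbit g a = orbit f a" if "a \<in> S" for a
  proof (rule orbit_cong0[symmetric, OF that])
    show "f \<in> S \<rightarrow> S" using assms(1) by (auto simp: bij_betw_def)
  qed (simp add: assms(2))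
  then have "orbit g ` S = orbit f ` S" by (rule image_cong[OF refl])
  then show ?thesis unfolding num_cycles_def by (simp only:)
qed

text \<open>The parity of \<open>card S + num_cycles f S\<close> is the sign of \<open>f\<close>, hence additive.\<close>

lemma even_num_cycles_comp_permutes:
  assumes "finite S" "bij_betw f S S" "g permutes S"
  shows "even (num_cycles (f \<circ> g) S + num_cycles f S + num_cycles g S + card S)"
  using assms(1,3)
proof (induct rule: permutes_rev_induct)
  case id
  have "orbit id = (\<lambda>x :: 'a. {x})"
    by (rule ext) (simp only: orbit_eq_singleton_iff id_apply)
  then have "num_cycles (id :: 'a \<Rightarrow> 'a) S = card S"
    unfolding num_cycles_def by (simp only: card_image inj_singleton)
  then show ?case unfolding comp_id by presburger
next
  case (swap a b p)
  \<comment> \<open>A transposition changes the cycle count by exactly one, up or down.\<close>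
  have step: "odd (num_cycles (h \<circ> transpose a b) S + num_cycles h S)" if "bij_betw h S S" for h
  proof (cases "orbit h a = orbit h b")
    case True
    show ?thesis
      unfolding num_cycles_comp_transpose_same[OF assms(1) that swap(1,2,3) True] by presburger
  next
    case False
    show ?thesis
      unfolding num_cycles_comp_transpose_diff[OF assms(1) that swap(1,2) False] by presburger
  qed
  have p: "bij_betw p S S" by (rule permutes_imp_bij[OF swap(5)])
  have parity: "even (a' + c + b' + s)" if "odd (a' + a)" "odd (b' + b)" "even (a + c + b + s)"
    for a a' b b' c s :: nat
    using that by presburger
  show ?case
    using parity[OF step[OF bij_betw_trans[OF p assms(2)]] step[OF p] swap(4)]
    by (simp only: comp_assoc)
qed

text \<open>Sign additivity for maps that only permute \<open>S\<close> as a set; \<open>g\<close>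
  is replaced by its continuation by the identity.\<close>

lemma even_num_cycles_comp:
  assumes "finite S" "bij_betw f S S" "bij_betw g S S"
  shows "even (num_cycles (f \<circ> g) S + num_cycles f S + num_cycles g S + card S)"
proof -
  let ?g = "perm_restrict g S"
  have g: "bij_betw ?g S S"
    using assms(3) by (rule bij_betw_cong[THEN iffD1, rotated]) (simp add: perm_restrict_simps)
  then have "?g permutes S"
    by (rule bij_imp_permutes) (simp add: perm_restrict_simps)
  moreover have "num_cycles ?g S = num_cycles g S"
    by (rule num_cycles_cong[OF assms(3)]) (simp add: perm_restrict_simps)
  moreover have "num_cycles (f \<circ> ?g) S = num_cycles (f \<circ> g) S"
    by (rule num_cycles_cong[OF bij_betw_trans[OF assms(3,2)]]) (simp add: perm_restrict_simps)
  ultimately show ?thesis using even_num_cycles_comp_permutes[OF assms(1,2)] by metis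
qed

section \<open>Block swaps in a rotation\<close>

lemma cyclic_on_imp_bij_betw:
  assumes "cyclic_on f D" "inj_on f D"
  shows "bij_betw f D D"
  unfolding bij_betw_def
  using assms cyclic_on_inI[OF assms(1)] endo_inj_surj[OF finite_cyclic_on[OF assms(1)]] by blast

text \<open>
  Composing the cycle \<open>z\<close> with \<open>transpose a p\<close> cuts it into two cycles; composing further with
  \<open>transpose p q\<close>, where \<open>q\<close> lies on the cycle of \<open>a\<close>, joins them again.
  If \<open>z\<close> agreed with \<open>x\<close> at every such \<open>q\<close>, then \<open>x\<close> would close up without reaching \<open>p\<close>.
\<close>

lemma cyclic_on_block_swap:
  assumes z: "cyclic_on z D" "inj_on z D" and x: "cyclic_on x D"
    and "a \<in> D" "p \<in> D" "z p = x a" "z a \<noteq> x a"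
  obtains q where "q \<in> D" "q \<noteq> a" "q \<noteq> p" "z q \<noteq> x q"
    "cyclic_on (z \<circ> transpose a p \<circ> transpose p q) D"
proof -
  let ?g = "z \<circ> transpose a p"
  have fin: "finite D" using finite_cyclic_on[OF z(1)] .
  have bz: "bij_betw z D D" by (rule cyclic_on_imp_bij_betw[OF z])
  have bg: "bij_betw ?g D D" by (rule bij_betw_comp_transpose[OF bz \<open>a \<in> D\<close> \<open>p \<in> D\<close>])
  have ap: "a \<noteq> p" using assms by metis
  have orbz: "orbit z d = D" if "d \<in> D" for d using orbit_cyclic_eq3[OF z(1) that] .
  have split: "orbit ?g a \<noteq> orbit ?g p"
    using orbz[OF \<open>a \<in> D\<close>] orbz[OF \<open>p \<in> D\<close>]
    by (intro orbit_comp_transpose_split[OF fin bz \<open>a \<in> D\<close> \<open>p \<in> D\<close> ap]) simp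
  have p_notin: "p \<notin> orbit ?g a"
    using split orbit_eq_iff_bij_betw[OF fin bg \<open>a \<in> D\<close> \<open>p \<in> D\<close>] by metis
  have a_in: "a \<in> orbit ?g a" by (rule bij_betw_self_in_orbit[OF fin bg \<open>a \<in> D\<close>])
  have "\<exists>q \<in> orbit ?g a. q \<noteq> a \<and> z q \<noteq> x q"
  proof (rule ccontr)
    assume neg: "\<not> ?thesis"
    have "x q = ?g q" if "q \<in> orbit ?g a" for q
    proof (cases "q = a")
      case True
      then show ?thesis using assms(6) by simp
    next
      case False
      moreover from that p_notin have "q \<noteq> p" by metis
      moreover have "z q = x q" using neg that False by blast
      ultimately show ?thesis by simp
    qed
    then have "orbit x a = orbit ?g a" by (intro orbit_cong a_in)
    moreover have "orbit x a = D" by (rule orbit_cyclic_eq3[OF x \<open>a \<in> D\<close>])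
    ultimately show False using p_notin \<open>p \<in> D\<close> by simp
  qed
  then obtain q where q: "q \<in> orbit ?g a" "q \<noteq> a" "z q \<noteq> x q" by blast
  have "q \<in> D" using q(1) orbit_subset_bij_betw[OF bg \<open>a \<in> D\<close>] by blast
  have "q \<noteq> p" using q(1) p_notin by metis
  let ?h = "?g \<circ> transpose p q"
  have orb_q: "orbit ?g q = orbit ?g a"
    by (rule orbit_eq_if_self_in[OF a_in q(1)])
  \<comment> \<open>Orbit bookkeeping: the single cycle of \<open>z\<close> becomes two, those of
    \<open>a\<close> and \<open>p\<close>, and \<open>transpose p q\<close> fuses them since
    \<open>q\<close> lies on the cycle of \<open>a\<close>.\<close>
  have "orbit z ` D = {D}" using orbz \<open>a \<in> D\<close> by auto
  then have "orbit ?g ` D = {orbit ?g a, orbit ?g p}"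
    using orbits_comp_transpose[OF fin bz \<open>a \<in> D\<close> \<open>p \<in> D\<close>] orbz[OF \<open>a \<in> D\<close>] by simp
  then have "orbit ?h ` D = {orbit ?h p, orbit ?h q}"
    using orbits_comp_transpose[OF fin bg \<open>p \<in> D\<close> \<open>q \<in> D\<close>] orb_q by auto
  moreover have "orbit ?h p = orbit ?h q"
    using split orb_q by (intro orbit_comp_transpose_merge[OF fin bg \<open>p \<in> D\<close> \<open>q \<in> D\<close>]) simp
  ultimately have single: "orbit ?h ` D = {orbit ?h p}" by simp
  have bh: "bij_betw ?h D D" by (rule bij_betw_comp_transpose[OF bg \<open>p \<in> D\<close> \<open>q \<in> D\<close>])
  have "D \<subseteq> orbit ?h p"
  proof
    fix d assume "d \<in> D"
    then have "orbit ?h d = orbit ?h p" using single by blast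
    then show "d \<in> orbit ?h p" using bij_betw_self_in_orbit[OF fin bh \<open>d \<in> D\<close>] by (simp only:)
  qed
  with orbit_subset_bij_betw[OF bh \<open>p \<in> D\<close>] have "cyclic_on ?h D"
    by (intro cyclic_on_singleI[OF \<open>p \<in> D\<close>]) (rule subset_antisym)
  with that q \<open>q \<in> D\<close> \<open>q \<noteq> p\<close> show thesis by blast
qed

context signed_graph
begin

section \<open>Moving one rotation system towards another\<close>

lemma rotation_system_permutes: "rotation_system G rot \<Longrightarrow> rot permutes arcs G"
  unfolding rotation_system_def by blast

lemma rotation_system_cyclic_on:
  assumes "rotation_system G rot" "a \<in> arcs G"
  shows "cyclic_on rot (out_arcs G (tail G a))"
proof -
  have "tail G a \<in> verts G" "a \<in> out_arcs G (tail G a)" using assms(2) by simp_all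
  with assms(1) show ?thesis unfolding rotation_system_def by blast
qed

lemma orbit_rotation_system:
  assumes "rotation_system G rot" "a \<in> arcs G"
  shows "orbit rot a = out_arcs G (tail G a)"
  using rotation_system_cyclic_on[OF assms] by (rule orbit_cyclic_eq3) (simp add: assms)

text \<open>The block swap changes \<open>z\<close> only at \<open>a\<close>, \<open>p\<close> and
  \<open>q\<close>. There \<open>z\<close> disagreed with \<open>x\<close> already (at
  \<open>p\<close> because \<open>z p = x a\<close> and \<open>x\<close> is injective), so no
  agreement is lost, and \<open>a\<close> now goes to \<open>z p = x a\<close>.\<close>

lemma rotation_system_closer:
  assumes z: "rotation_system G z" and x: "rotation_system G x" and a: "a \<in> arcs G" "z a \<noteq> x a"
  obtains p q where "p \<in> arcs G" "q \<in> arcs G" "p = inv z (x a)"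
    "rotation_system G (z \<circ> transpose a p \<circ> transpose p q)"
    "card {e \<in> arcs G. (z \<circ> transpose a p \<circ> transpose p q) e \<noteq> x e} < card {e \<in> arcs G. z e \<noteq> x e}"
proof -
  note zp = rotation_system_permutes[OF z]
  let ?D = "out_arcs G (tail G a)"
  have cz: "cyclic_on z ?D" and cx: "cyclic_on x ?D"
    using z x a by (auto intro: rotation_system_cyclic_on)
  have injz: "inj z" by (rule permutes_inj[OF zp])
  define p where "p = inv z (x a)"
  have zp_p: "z p = x a" unfolding p_def using permutes_inverses(1)[OF zp] .
  have aD: "a \<in> ?D" using a by simp
  have "z p \<in> ?D" unfolding zp_p by (rule cyclic_on_inI[OF cx aD])
  then have pD: "p \<in> ?D" by (rule cyclic_on_f_in[OF zp cz])
  from cyclic_on_block_swap[OF cz inj_on_subset[OF injz subset_UNIV] cx aD pD zp_p a(2)]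
  obtain q where q: "q \<in> ?D" "q \<noteq> a" "q \<noteq> p" "z q \<noteq> x q"
      "cyclic_on (z \<circ> transpose a p \<circ> transpose p q) ?D" by blast
  let ?z = "z \<circ> transpose a p \<circ> transpose p q"
  have pq: "p \<in> arcs G" "q \<in> arcs G" using pD q(1) by simp_all
  have "?z permutes arcs G"
    by (intro permutes_compose[OF permutes_swap_id] zp a(1) pq)
  moreover have "cyclic_on ?z (out_arcs G v)" if v: "v \<in> verts G" "out_arcs G v \<noteq> {}" for v
  proof (cases "v = tail G a")
    case False
    have "cyclic_on z (out_arcs G v)" using z v unfolding rotation_system_def by blast
    moreover have "z s = ?z s" if "s \<in> out_arcs G v" for s
    proof -
      have "s \<noteq> a" "s \<noteq> p" "s \<noteq> q" using that aD pD q(1) False by auto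
      then show ?thesis by simp
    qed
    ultimately show ?thesis using cyclic_cong[of "out_arcs G v" z ?z] by blast
  qed (use q(5) in simp)
  ultimately have rot: "rotation_system G ?z" unfolding rotation_system_def by blast
  have ap: "a \<noteq> p" using zp_p a(2) by metis
  have za: "?z a = x a" using q(2) ap zp_p by simp
  have "x a \<noteq> x p" using ap permutes_inj[OF rotation_system_permutes[OF x]] by (simp add: inj_eq)
  then have xp: "z p \<noteq> x p" using zp_p by simp
  have sub: "{e \<in> arcs G. ?z e \<noteq> x e} \<subseteq> {e \<in> arcs G. z e \<noteq> x e}"
  proof
    fix e assume e: "e \<in> {e \<in> arcs G. ?z e \<noteq> x e}"
    show "e \<in> {e \<in> arcs G. z e \<noteq> x e}"
    proof (cases "e \<in> {a, p, q}")
      case True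
      with e a(2) xp q(4) show ?thesis by blast
    next
      case False
      then have "?z e = z e" by simp
      with e show ?thesis by simp
    qed
  qed
  have "card {e \<in> arcs G. ?z e \<noteq> x e} < card {e \<in> arcs G. z e \<noteq> x e}"
  proof (rule psubset_card_mono)
    show "{e \<in> arcs G. ?z e \<noteq> x e} \<subset> {e \<in> arcs G. z e \<noteq> x e}"
      using sub a za by blast
  qed simp
  with that pq p_def rot show thesis by blast
qed

section \<open>Facial walks\<close>

abbreviation states :: "('a \<times> int) set" where
  "states \<equiv> arcs G \<times> {1, - 1}"

abbreviation step :: "('a \<Rightarrow> 'a) \<Rightarrow> 'a \<times> int \<Rightarrow> 'a \<times> int" where
  "step \<equiv> face_step arev \<sigma>"

abbreviation rev_state :: "'a \<times> int \<Rightarrow> 'a \<times> int" where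
  "rev_state \<equiv> face_rev arev \<sigma>"

text \<open>
  The states whose next step turns through the corner between the darts \<open>a\<close> and \<open>rot a\<close>:
  \<open>pos_state a\<close> leaves along \<open>rot a\<close>, and \<open>neg_state rot a\<close> leaves along \<open>a\<close>.
\<close>

definition pos_state :: "'a \<Rightarrow> 'a \<times> int" where
  "pos_state a = (arev a, \<sigma> a)"

definition neg_state :: "('a \<Rightarrow> 'a) \<Rightarrow> 'a \<Rightarrow> 'a \<times> int" where
  "neg_state rot a = (arev (rot a), - \<sigma> (rot a))"

section \<open>Face steps and their reversal\<close>

lemma sign_cases: "a \<in> arcs G \<Longrightarrow> \<sigma> a = 1 \<or> \<sigma> a = - 1"
  using sign_values by blast

lemma step_pos_state:
  assumes "a \<in> arcs G"
  shows "step rot (pos_state a) = (rot a, 1)"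
  using sign_cases[OF assms] sign_arev[OF assms] unfolding pos_state_def face_step_def by auto

text \<open>The state is named by the corners of \<open>rot\<close> but the walk follows
  \<open>rot'\<close>; this allows comparing two rotations on the same states.\<close>

lemma step_neg_state:
  assumes "rot a \<in> arcs G"
  shows "step rot' (neg_state rot a) = (inv rot' (rot a), - 1)"
  using sign_cases[OF assms] sign_arev[OF assms] unfolding neg_state_def face_step_def by auto

lemma step_neg_state_same:
  assumes "rot permutes arcs G" "a \<in> arcs G"
  shows "step rot (neg_state rot a) = (a, - 1)"
  using step_neg_state[of rot a rot] assms by (simp add: permutes_in_image permutes_inverses)

lemma pos_state_in_states: "a \<in> arcs G \<Longrightarrow> pos_state a \<in> states"
  unfolding pos_state_def using sign_cases by force

lemma neg_state_in_states: "rot permutes arcs G \<Longrightarrow> a \<in> arcs G \<Longrightarrow> neg_state rot a \<in> states"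
  unfolding neg_state_def using sign_cases[of "rot a"] by (auto simp: permutes_in_image)

text \<open>A state \<open>(b, s)\<close> turns at the corner after \<open>arev b\<close> if
  \<open>s\<close> equals the sign of that dart, and otherwise at the corner before it, which is
  named by \<open>inv rot (arev b)\<close>.\<close>

lemma states_cases:
  assumes "rot permutes arcs G" "y \<in> states"
  obtains a where "a \<in> arcs G" "y = pos_state a" | a where "a \<in> arcs G" "y = neg_state rot a"
proof -
  obtain b s where y: "y = (b, s)" "b \<in> arcs G" "s = 1 \<or> s = - 1" using assms(2) by auto
  have sb: "\<sigma> (arev b) = 1 \<or> \<sigma> (arev b) = - 1" using y(2) by (intro sign_cases) simp
  show thesis
  proof (cases "s = \<sigma> (arev b)")
    case True
    then show ?thesis using that(1)[of "arev b"] y by (simp add: pos_state_def)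
  next
    case False
    then have "s = - \<sigma> (arev b)" using sb y(3) by auto
    moreover have "rot (inv rot (arev b)) = arev b" using assms(1) by (rule permutes_inverses)
    moreover have "inv rot (arev b) \<in> arcs G"
      using y(2) by (simp add: permutes_in_image[OF permutes_inv[OF assms(1)]])
    ultimately show ?thesis using that(2)[of "inv rot (arev b)"] y(1) by (simp add: neg_state_def)
  qed
qed

lemma rev_state_involutive: "y \<in> states \<Longrightarrow> rev_state (rev_state y) = y"
  unfolding face_rev_def using sign_arev sign_cases by (auto split: prod.splits) force+

lemma rev_state_in_states: "y \<in> states \<Longrightarrow> rev_state y \<in> states"
  unfolding face_rev_def using sign_cases by (auto split: prod.splits) force+

lemma rev_state_neq: "y \<in> states \<Longrightarrow> rev_state y \<noteq> y"
  unfolding face_rev_def using arev_neq by (auto split: prod.splits)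

lemma rev_pos_state:
  assumes "a \<in> arcs G"
  shows "rev_state (pos_state a) = (a, - 1)"
  using sign_cases[OF assms] sign_arev[OF assms] unfolding pos_state_def face_rev_def by auto

lemma rev_neg_state:
  assumes "rot a \<in> arcs G"
  shows "rev_state (neg_state rot a) = (rot a, 1)"
  using sign_cases[OF assms] sign_arev[OF assms] unfolding neg_state_def face_rev_def by auto

lemma finite_states: "finite states"
  by simp

text \<open>Surjectivity suffices on a finite set: \<open>(b, 1)\<close> is reached from the
  positive state of the predecessor of \<open>b\<close>, and \<open>(b, - 1)\<close> from
  \<open>neg_state rot b\<close>.\<close>

lemma bij_betw_step:
  assumes "rot permutes arcs G"
  shows "bij_betw (step rot) states states"
proof -
  have "step rot ` states = states"
  proof (intro equalityI subsetI)
    fix w assume "w \<in> step rot ` states"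
    then obtain y where y: "y \<in> states" "w = step rot y" by blast
    from assms y(1) show "w \<in> states"
    proof (cases rule: states_cases)
      case (1 a)
      then show ?thesis using assms y(2) by (simp add: step_pos_state permutes_in_image)
    next
      case (2 a)
      then show ?thesis using assms y(2) by (simp add: step_neg_state_same)
    qed
  next
    fix w assume "w \<in> states"
    then obtain b where b: "b \<in> arcs G" "w = (b, 1) \<or> w = (b, - 1)" by auto
    from b(2) show "w \<in> step rot ` states"
    proof
      assume w: "w = (b, 1)"
      have "inv rot b \<in> arcs G" using b(1) by (simp add: permutes_in_image[OF permutes_inv[OF assms]])
      moreover from this have "step rot (pos_state (inv rot b)) = w"
        using w by (simp add: step_pos_state permutes_inverses[OF assms])
      ultimately show ?thesis using pos_state_in_states by blast
    next
      assume "w = (b, - 1)"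
      then show ?thesis
        using step_neg_state_same[OF assms b(1)] neg_state_in_states[OF assms b(1)] by force
    qed
  qed
  then show ?thesis
    unfolding bij_betw_def by (auto intro: eq_card_imp_inj_on)
qed

lemma step_in_states: "rot permutes arcs G \<Longrightarrow> y \<in> states \<Longrightarrow> step rot y \<in> states"
  using bij_betw_step by (blast dest: bij_betw_apply)

text \<open>Reversal conjugates the step to its inverse: reversing the outcome of one state of a
  corner gives the other state of that corner.\<close>

lemma step_rev_step:
  assumes "rot permutes arcs G" "y \<in> states"
  shows "step rot (rev_state (step rot y)) = rev_state y"
  using assms
proof (cases rule: states_cases)
  case (1 a)
  have ra: "rot a \<in> arcs G" using 1 assms by (simp add: permutes_in_image)
  have "rev_state (rot a, 1) = neg_state rot a"
    unfolding face_rev_def neg_state_def by simp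
  then show ?thesis
    using 1 ra assms by (simp add: step_pos_state step_neg_state_same rev_pos_state)
next
  case (2 a)
  have ra: "rot a \<in> arcs G" using 2 assms by (simp add: permutes_in_image)
  have "rev_state (a, - 1) = pos_state a"
    unfolding face_rev_def pos_state_def by simp
  then show ?thesis
    using 2 ra assms by (simp add: step_pos_state step_neg_state_same rev_neg_state)
qed

lemma step_neq_rev_state:
  assumes "rot permutes arcs G" "y \<in> states"
  shows "step rot y \<noteq> rev_state y"
  using assms
proof (cases rule: states_cases)
  case (1 a)
  then show ?thesis by (simp add: step_pos_state rev_pos_state)
next
  case (2 a)
  then show ?thesis using assms by (simp add: step_neg_state_same rev_neg_state permutes_in_image)
qed

text \<open>A walk never meets its own reversal. If it did after \<open>n + 2\<close> steps,
  removing one step at each end would give a meeting after \<open>n\<close> steps from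
  \<open>step rot y\<close>; lengths 0 and 1 are excluded directly.\<close>

lemma funpow_step_neq_rev_state:
  assumes "rot permutes arcs G" "y \<in> states"
  shows "(step rot ^^ n) y \<noteq> rev_state y"
  using assms(2)
proof (induct n arbitrary: y rule: induct_nat_012)
  case 0
  then show ?case using rev_state_neq by force
next
  case 1
  then show ?case using step_neq_rev_state[OF assms(1)] by simp
next
  case (ge2 n)
  let ?y = "step rot y"
  have y: "?y \<in> states" by (rule step_in_states[OF assms(1) ge2(3)])
  have iter: "(step rot ^^ n) ?y \<in> states" for n
    by (induct n) (use y step_in_states[OF assms(1)] in auto)
  show ?case
  proof
    assume "(step rot ^^ Suc (Suc n)) y = rev_state y"
    then have "step rot ((step rot ^^ n) ?y) = step rot (rev_state ?y)"
      using step_rev_step[OF assms(1) ge2(3)] by (simp add: funpow_swap1)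
    then have "(step rot ^^ n) ?y = rev_state ?y"
      using bij_betw_step[OF assms(1)] iter rev_state_in_states[OF y]
      unfolding bij_betw_def by (meson inj_onD)
    with ge2(1)[OF y] show False by blast
  qed
qed

lemma rev_state_notin_orbit:
  assumes "rot permutes arcs G" "y \<in> states"
  shows "rev_state y \<notin> orbit (step rot) y"
  using funpow_step_neq_rev_state[OF assms] unfolding orbit_altdef by force

text \<open>The reversed walk runs backwards, but an orbit of a bijection of a finite set is the
  same in both directions. The second inclusion is the first one applied to
  \<open>rev_state y\<close>.\<close>

lemma orbit_rev_state:
  assumes "rot permutes arcs G" "y \<in> states"
  shows "orbit (step rot) (rev_state y) = rev_state ` orbit (step rot) y"
proof -
  note bij = bij_betw_step[OF assms(1)]
  have sub: "rev_state ` orbit (step rot) y \<subseteq> orbit (step rot) (rev_state y)" if y: "y \<in> states" for y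
  proof
    fix w assume "w \<in> rev_state ` orbit (step rot) y"
    then obtain u where u: "u \<in> orbit (step rot) y" "w = rev_state u" by blast
    from u(1) have "u \<in> states \<and> rev_state y \<in> orbit (step rot) (rev_state u)"
    proof induct
      case base
      show ?case
        using step_in_states[OF assms(1) y] step_rev_step[OF assms(1) y] by (metis orbit.base)
    next
      case (step u)
      then have "rev_state u \<in> orbit (step rot) (rev_state (step rot u))"
        using step_rev_step[OF assms(1)] by (metis orbit.base)
      then show ?case using step step_in_states[OF assms(1)] orbit_trans by metis
    qed
    then show "w \<in> orbit (step rot) (rev_state y)"
      using u(2) orbit_swap bij_betw_self_in_orbit[OF finite_states bij] rev_state_in_states by metis
  qed
  have "orbit (step rot) (rev_state y) \<subseteq> rev_state ` orbit (step rot) y"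
  proof
    fix w assume w: "w \<in> orbit (step rot) (rev_state y)"
    have "rev_state w \<in> orbit (step rot) y"
      using sub[OF rev_state_in_states[OF assms(2)]] w rev_state_involutive[OF assms(2)] by auto
    moreover have "w \<in> states"
      using w orbit_subset_bij_betw[OF bij rev_state_in_states[OF assms(2)]] by blast
    ultimately show "w \<in> rev_state ` orbit (step rot) y"
      using rev_state_involutive by force
  qed
  with sub[OF assms(2)] show ?thesis by blast
qed

section \<open>Choosing one orientation for every face\<close>

text \<open>
  A half system contains exactly one of the two mirror-image walks of each face; it amounts to
  an orientation of every face.
\<close>

definition half_system :: "('a \<Rightarrow> 'a) \<Rightarrow> ('a \<times> int) set \<Rightarrow> bool" where
  "half_system rot H \<longleftrightarrow> H \<subseteq> states \<and> (\<forall>y \<in> H. step rot y \<in> H) \<and>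
     (\<forall>y \<in> states. rev_state y \<in> H \<longleftrightarrow> y \<notin> H)"

abbreviation face :: "('a \<Rightarrow> 'a) \<Rightarrow> 'a \<times> int \<Rightarrow> ('a \<times> int) set" where
  "face rot y \<equiv> orbit (step rot) y \<union> rev_state ` orbit (step rot) y"

lemma face_rev_state:
  assumes "rot permutes arcs G" "y \<in> states"
  shows "face rot (rev_state y) = face rot y"
proof -
  have "rev_state ` orbit (step rot) (rev_state y) = orbit (step rot) y"
    using orbit_rev_state[OF assms(1) rev_state_in_states[OF assms(2)]] rev_state_involutive[OF assms(2)]
    by simp
  then show ?thesis using orbit_rev_state[OF assms] by blast
qed

lemma face_of_step:
  assumes "rot permutes arcs G" "y \<in> states"
  shows "face rot (step rot y) = face rot y"
  using self_in_orbit_step[OF bij_betw_self_in_orbit[OF finite_states bij_betw_step[OF assms(1)] assms(2)]]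
  by simp

text \<open>Each face gets a representative state, and \<open>H\<close> collects the walks of the
  representatives. By \<open>rev_state_notin_orbit\<close> such a walk never contains a state
  together with its reversal.\<close>

lemma half_system_exists:
  assumes "rot permutes arcs G"
  obtains H where "half_system rot H"
proof -
  note bij = bij_betw_step[OF assms(1)]
  note self = bij_betw_self_in_orbit[OF finite_states bij]
  define rep where "rep T = (SOME y. y \<in> states \<and> T = face rot y)" for T
  have rep: "rep (face rot y) \<in> states" "face rot y = face rot (rep (face rot y))"
    if "y \<in> states" for y
  proof -
    have "rep (face rot y) \<in> states \<and> face rot y = face rot (rep (face rot y))"
      unfolding rep_def by (rule someI[of _ y]) (intro conjI that refl)
    then show "rep (face rot y) \<in> states" "face rot y = face rot (rep (face rot y))" by blast+
  qed
  define H where "H = {y \<in> states. y \<in> orbit (step rot) (rep (face rot y))}"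
  have "step rot y \<in> H" if "y \<in> H" for y
  proof -
    have y: "y \<in> states" "y \<in> orbit (step rot) (rep (face rot y))" using that unfolding H_def by blast+
    show ?thesis
      unfolding H_def mem_Collect_eq face_of_step[OF assms y(1)]
      using step_in_states[OF assms y(1)] orbit.step[OF y(2)] by blast
  qed
  moreover have "rev_state y \<in> H \<longleftrightarrow> y \<notin> H" if y: "y \<in> states" for y
  proof -
    let ?r = "rep (face rot y)"
    have H: "y \<in> H \<longleftrightarrow> y \<in> orbit (step rot) ?r"
      using y unfolding H_def by blast
    have rev_H: "rev_state y \<in> H \<longleftrightarrow> rev_state y \<in> orbit (step rot) ?r"
      using rev_state_in_states[OF y] unfolding H_def mem_Collect_eq face_rev_state[OF assms y] by blast
    have "y \<in> face rot y" using self[OF y] by (rule UnI1)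
    then have "y \<in> face rot ?r" by (subst (asm) rep(2)[OF y])
    then have "y \<in> orbit (step rot) ?r \<or> rev_state y \<in> orbit (step rot) ?r"
    proof
      assume "y \<in> rev_state ` orbit (step rot) ?r"
      then obtain u where u: "u \<in> orbit (step rot) ?r" "y = rev_state u" by blast
      then have "rev_state y = u"
        using orbit_subset_bij_betw[OF bij rep(1)[OF y]] rev_state_involutive by blast
      with u(1) show ?thesis by blast
    qed blast
    moreover have "rev_state y \<notin> orbit (step rot) ?r" if "y \<in> orbit (step rot) ?r"
      using orbit_eq_if_self_in[OF self[OF rep(1)[OF y]] that] rev_state_notin_orbit[OF assms y]
      by (simp only: not_False_eq_True)
    ultimately show ?thesis using H rev_H by blast
  qed
  moreover have "H \<subseteq> states" unfolding H_def by (rule Collect_restrict)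
  ultimately have "half_system rot H" unfolding half_system_def by (intro conjI ballI)
  then show thesis by (rule that)
qed

lemma bij_betw_step_half_system:
  assumes "rot permutes arcs G" "half_system rot H"
  shows "bij_betw (step rot) H H"
proof -
  have "H \<subseteq> states" "step rot ` H \<subseteq> H" using assms(2) unfolding half_system_def by auto
  moreover from this have "finite H" using finite_subset[OF _ finite_states] by blast
  moreover have "inj_on (step rot) H"
    using bij_betw_imp_inj_on[OF bij_betw_step[OF assms(1)]] \<open>H \<subseteq> states\<close> by (rule inj_on_subset)
  ultimately show ?thesis unfolding bij_betw_def using endo_inj_surj by blast
qed

text \<open>Intersecting a face with \<open>H\<close> recovers exactly one of its two walks.\<close>

lemma card_traced_faces_half_system:
  assumes "rot permutes arcs G" "half_system rot H"
  shows "card (traced_faces G arev \<sigma> rot) = num_cycles (step rot) H"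
proof -
  have sub: "H \<subseteq> states" and rev: "\<And>y. y \<in> states \<Longrightarrow> rev_state y \<in> H \<longleftrightarrow> y \<notin> H"
    using assms(2) unfolding half_system_def by blast+
  have "traced_faces G arev \<sigma> rot = face rot ` states" unfolding traced_faces_def ..
  also have "\<dots> = face rot ` H"
  proof (rule subset_antisym[OF subsetI image_mono[OF sub]])
    fix T assume "T \<in> face rot ` states"
    then obtain y where y: "y \<in> states" "T = face rot y" by blast
    show "T \<in> face rot ` H"
    proof (cases "y \<in> H")
      case False
      then have "rev_state y \<in> H" using rev[OF y(1)] by blast
      moreover have "T = face rot (rev_state y)"
        unfolding y(2) by (rule face_rev_state[OF assms(1) y(1), symmetric])
      ultimately show ?thesis by blast
    qed (use y(2) in blast)
  qed
  also have "\<dots> = (\<lambda>T. T \<union> rev_state ` T) ` orbit (step rot) ` H"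
    by (simp only: image_image)
  finally have "traced_faces G arev \<sigma> rot = \<dots>" .
  moreover have "inj_on (\<lambda>T. T \<union> rev_state ` T) (orbit (step rot) ` H)"
  proof (rule inj_on_inverseI)
    fix T assume "T \<in> orbit (step rot) ` H"
    then have "T \<subseteq> H"
      using orbit_subset_bij_betw[OF bij_betw_step_half_system[OF assms]] by auto
    then show "(T \<union> rev_state ` T) \<inter> H = T" using sub rev by blast
  qed
  ultimately show ?thesis unfolding num_cycles_def by (simp add: card_image)
qed

text \<open>The states split into \<open>H\<close> and its mirror image, each containing one orbit
  per face.\<close>

lemma num_cycles_step:
  assumes "rot permutes arcs G"
  shows "num_cycles (step rot) states = 2 * card (traced_faces G arev \<sigma> rot)"
proof -
  obtain H where H: "half_system rot H" using half_system_exists[OF assms] .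
  have sub: "H \<subseteq> states" and rev: "\<And>y. y \<in> states \<Longrightarrow> rev_state y \<in> H \<longleftrightarrow> y \<notin> H"
    using H unfolding half_system_def by blast+
  note bij = bij_betw_step_half_system[OF assms H]
  have orb_sub: "T \<subseteq> H" if "T \<in> orbit (step rot) ` H" for T
    using that orbit_subset_bij_betw[OF bij] by auto
  have finH: "finite H" using sub finite_states finite_subset by blast
  have inj_rev: "inj_on rev_state states"
    by (rule inj_on_inverseI[of _ rev_state]) (rule rev_state_involutive)
  have "states = H \<union> rev_state ` H"
  proof (intro equalityI subsetI)
    fix y assume y: "y \<in> states"
    show "y \<in> H \<union> rev_state ` H"
    proof (cases "y \<in> H")
      case False
      then have "rev_state y \<in> H" using rev[OF y] by blast
      then have "rev_state (rev_state y) \<in> rev_state ` H" by (rule imageI)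
      then show ?thesis using rev_state_involutive[OF y] by simp
    qed simp
  next
    fix y assume "y \<in> H \<union> rev_state ` H"
    then show "y \<in> states" using sub rev_state_in_states by blast
  qed
  then have "orbit (step rot) ` states
      = orbit (step rot) ` H \<union> (\<lambda>y. orbit (step rot) (rev_state y)) ` H"
    by (metis image_Un image_image)
  also have "(\<lambda>y. orbit (step rot) (rev_state y)) ` H = (`) rev_state ` orbit (step rot) ` H"
    unfolding image_image using sub orbit_rev_state[OF assms] by (intro image_cong) auto
  finally have img: "orbit (step rot) ` states
      = orbit (step rot) ` H \<union> (`) rev_state ` orbit (step rot) ` H" .
  have disj: "orbit (step rot) ` H \<inter> (`) rev_state ` orbit (step rot) ` H = {}"
  proof -
    have "rev_state ` T \<noteq> T'" if T: "T \<in> orbit (step rot) ` H" "T' \<in> orbit (step rot) ` H" for T T'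
    proof -
      have "T \<noteq> {}" using T(1) orbit_nonempty[of "step rot"] by auto
      then obtain y where "y \<in> T" by blast
      then have "rev_state y \<notin> H" using rev orb_sub[OF T(1)] sub by blast
      then show ?thesis using orb_sub[OF T(2)] \<open>y \<in> T\<close> by blast
    qed
    then show ?thesis by blast
  qed
  have "inj_on ((`) rev_state) (orbit (step rot) ` H)"
  proof (rule inj_onI)
    fix T T' assume T: "T \<in> orbit (step rot) ` H" "T' \<in> orbit (step rot) ` H"
      and eq: "rev_state ` T = rev_state ` T'"
    have "T \<subseteq> states" "T' \<subseteq> states" using orb_sub[OF T(1)] orb_sub[OF T(2)] sub by auto
    then show "T = T'" using inj_on_image_eq_iff[OF inj_rev] eq by blast
  qed
  then have "num_cycles (step rot) states = 2 * num_cycles (step rot) H"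
    unfolding num_cycles_def img using disj finH by (simp add: card_Un_disjoint card_image)
  then show ?thesis using card_traced_faces_half_system[OF assms H] by simp
qed

section \<open>How a block swap changes the faces\<close>

text \<open>Positive states see the rotation and so undergo the same transpositions as the darts;
  negative states see its inverse, hence the reversed order.\<close>

lemma step_comp_transposes:
  assumes z: "rot permutes arcs G" and arcs: "a \<in> arcs G" "p \<in> arcs G" "q \<in> arcs G"
    and y: "y \<in> states"
  shows "step (rot \<circ> transpose a p \<circ> transpose p q) y =
    (step rot \<circ> transpose (pos_state a) (pos_state p) \<circ> transpose (pos_state p) (pos_state q)
      \<circ> transpose (neg_state rot p) (neg_state rot q) \<circ> transpose (neg_state rot a) (neg_state rot p)) y"
proof -
  let ?z = "rot \<circ> transpose a p \<circ> transpose p q"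
  have zp: "?z permutes arcs G"
    by (intro permutes_compose[OF permutes_swap_id] z arcs)
  have inj_pos: "inj_on pos_state (arcs G)"
    using arev_arev by (intro inj_onI) (metis pos_state_def prod.inject)
  have inj_neg: "inj_on (neg_state rot) (arcs G)"
    using permutes_inj[OF z] arev_arev by (intro inj_onI) (metis inj_eq neg_state_def prod.inject)
  \<comment> \<open>Equality would force \<open>d = rot e\<close> and a sign equal to its own
    negative. Thus transpositions of one kind of state fix the other kind.\<close>
  have pos_neg: "pos_state d \<noteq> neg_state rot e" if "d \<in> arcs G" "e \<in> arcs G" for d e
  proof
    assume "pos_state d = neg_state rot e"
    then have "arev d = arev (rot e)" "\<sigma> d = - \<sigma> (rot e)" unfolding pos_state_def neg_state_def by auto
    then have "\<sigma> d = - \<sigma> d" using arev_arev by metis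
    then show False using sign_cases[OF that(1)] by auto
  qed
  have tr_arcs: "transpose b c e \<in> arcs G" if "b \<in> arcs G" "c \<in> arcs G" "e \<in> arcs G" for b c e
    using that by (simp add: transpose_def)
  have tr_pos: "transpose (pos_state b) (pos_state c) (pos_state e) = pos_state (transpose b c e)"
    if "b \<in> arcs G" "c \<in> arcs G" "e \<in> arcs G" for b c e
    using that inj_onD[OF inj_pos] by (auto simp: transpose_def)
  have tr_neg: "transpose (neg_state rot b) (neg_state rot c) (neg_state rot e) = neg_state rot (transpose b c e)"
    if "b \<in> arcs G" "c \<in> arcs G" "e \<in> arcs G" for b c e
    using that inj_onD[OF inj_neg] by (auto simp: transpose_def)
  have tr_pos_neg: "transpose (pos_state b) (pos_state c) (neg_state rot e) = neg_state rot e"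
    "transpose (neg_state rot b) (neg_state rot c) (pos_state e) = pos_state e"
    if "b \<in> arcs G" "c \<in> arcs G" "e \<in> arcs G" for b c e
    using that pos_neg[of b e] pos_neg[of c e] pos_neg[of e b] pos_neg[of e c]
    by (auto simp: transpose_def)
  from z y show ?thesis
  proof (cases rule: states_cases)
    case (1 e)
    let ?e = "transpose a p (transpose p q e)"
    have e: "?e \<in> arcs G" "transpose p q e \<in> arcs G" using 1(1) arcs by (auto intro: tr_arcs)
    have "step ?z (pos_state e) = (rot ?e, 1)" using 1(1) by (simp add: step_pos_state)
    also have "\<dots> = step rot (pos_state ?e)" using e by (simp add: step_pos_state)
    also have "pos_state ?e = transpose (pos_state a) (pos_state p)
        (transpose (pos_state p) (pos_state q) (pos_state e))"
      using tr_pos arcs 1(1) e by simp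
    finally show ?thesis
      by (simp only: 1(2) comp_apply[of _ _ "u :: 'a \<times> int" for u] tr_pos_neg(2)[OF arcs(1,2) 1(1)] tr_pos_neg(2)[OF arcs(2,3) 1(1)])
  next
    case (2 e)
    let ?e = "transpose p q (transpose a p e)"
    have e: "?e \<in> arcs G" "transpose a p e \<in> arcs G" using 2(1) arcs by (auto intro: tr_arcs)
    have re: "rot e \<in> arcs G" using z 2(1) by (simp add: permutes_in_image)
    have "?z ?e = rot e" by simp
    then have "inv ?z (rot e) = ?e" using permutes_inverses(2)[OF zp] by metis
    then have "step ?z (neg_state rot e) = (?e, - 1)" using re by (simp add: step_neg_state)
    also have "\<dots> = step rot (neg_state rot ?e)" using e z by (simp add: step_neg_state_same)
    also have "neg_state rot ?e = transpose (neg_state rot p) (neg_state rot q)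
        (transpose (neg_state rot a) (neg_state rot p) (neg_state rot e))"
      using tr_neg arcs 2(1) e by simp
    finally show ?thesis
      by (simp only: 2(2) comp_apply[of _ _ "u :: 'a \<times> int" for u] tr_neg[OF arcs(1,2) 2(1)] tr_neg[OF arcs(2,3) e(2)]
          tr_pos_neg(1)[OF arcs(1,2) e(1)] tr_pos_neg(1)[OF arcs(2,3) e(1)])
  qed
qed

text \<open>Four transpositions add at most four orbits of states, and a face is two orbits. Gaining
  two faces forces every transposition to split an orbit, in particular the first, which exchanges
  the positive states of \<open>a\<close> and \<open>p\<close>.\<close>

lemma card_traced_faces_block_swap:
  assumes z: "rot permutes arcs G" and arcs: "a \<in> arcs G" "p \<in> arcs G" "q \<in> arcs G"
  defines "rot' \<equiv> rot \<circ> transpose a p \<circ> transpose p q"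
  shows "card (traced_faces G arev \<sigma> rot') \<le> card (traced_faces G arev \<sigma> rot) + 2"
    and "card (traced_faces G arev \<sigma> rot') = card (traced_faces G arev \<sigma> rot) + 2 \<Longrightarrow>
      orbit (step rot) (pos_state a) = orbit (step rot) (pos_state p)"
proof -
  let ?f1 = "step rot \<circ> transpose (pos_state a) (pos_state p)"
  let ?f2 = "?f1 \<circ> transpose (pos_state p) (pos_state q)"
  let ?f3 = "?f2 \<circ> transpose (neg_state rot p) (neg_state rot q)"
  let ?f4 = "?f3 \<circ> transpose (neg_state rot a) (neg_state rot p)"
  note S = pos_state_in_states[OF arcs(1)] pos_state_in_states[OF arcs(2)] pos_state_in_states[OF arcs(3)]
    neg_state_in_states[OF z arcs(1)] neg_state_in_states[OF z arcs(2)] neg_state_in_states[OF z arcs(3)]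
  note b0 = bij_betw_step[OF z]
  note b1 = bij_betw_comp_transpose[OF b0 S(1,2)]
  note b2 = bij_betw_comp_transpose[OF b1 S(2,3)]
  note b3 = bij_betw_comp_transpose[OF b2 S(5,6)]
  note b4 = bij_betw_comp_transpose[OF b3 S(4,5)]
  have "rot' permutes arcs G"
    unfolding rot'_def by (intro permutes_compose[OF permutes_swap_id] z arcs)
  then have "2 * card (traced_faces G arev \<sigma> rot') = num_cycles (step rot') states"
    by (rule num_cycles_step[symmetric])
  also have "\<dots> = num_cycles ?f4 states"
    unfolding rot'_def by (rule num_cycles_cong[OF b4 step_comp_transposes[OF z arcs]])
  \<comment> \<open>The first transposition is left unestimated, since both claims depend on its
    effect.\<close>
  also have "\<dots> \<le> num_cycles ?f1 states + 3"
    using num_cycles_comp_transpose_le[OF finite_states b1 S(2,3)]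
      num_cycles_comp_transpose_le[OF finite_states b2 S(5,6)]
      num_cycles_comp_transpose_le[OF finite_states b3 S(4,5)] by linarith
  finally have le: "2 * card (traced_faces G arev \<sigma> rot') \<le> num_cycles ?f1 states + 3" .
  note c0 = num_cycles_step[OF z]
  show "card (traced_faces G arev \<sigma> rot') \<le> card (traced_faces G arev \<sigma> rot) + 2"
    using le c0 num_cycles_comp_transpose_le[OF finite_states b0 S(1,2)] by linarith
  assume eq: "card (traced_faces G arev \<sigma> rot') = card (traced_faces G arev \<sigma> rot) + 2"
  show "orbit (step rot) (pos_state a) = orbit (step rot) (pos_state p)"
  proof (rule ccontr)
    assume "orbit (step rot) (pos_state a) \<noteq> orbit (step rot) (pos_state p)"
    from num_cycles_comp_transpose_diff[OF finite_states b0 S(1,2) this] show False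
      using le c0 eq by linarith
  qed
qed

section \<open>Parity of the number of faces\<close>

text \<open>The cycles are the sets of darts leaving the non-isolated vertices, whatever the
  rotation.\<close>

lemma num_cycles_rotation_system:
  assumes "rotation_system G rot" "rotation_system G rot'"
  shows "num_cycles rot (arcs G) = num_cycles rot' (arcs G)"
  unfolding num_cycles_def using orbit_rotation_system assms by (simp cong: image_cong_simp)

text \<open>Rotation systems have equally many cycles and hence equal sign, so their quotient is an
  even permutation.\<close>

lemma even_num_cycles_rotation_quotient:
  assumes z: "rotation_system G z" and x: "rotation_system G x"
  shows "even (num_cycles (inv z \<circ> x) (arcs G) + card (arcs G))"
proof -
  note zp = rotation_system_permutes[OF z] and xp = rotation_system_permutes[OF x]
  have "z \<circ> (inv z \<circ> x) = x"
    using permutes_inverses(1)[OF zp] by (simp add: fun_eq_iff)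
  moreover have "even (num_cycles (z \<circ> (inv z \<circ> x)) (arcs G) + num_cycles z (arcs G)
      + num_cycles (inv z \<circ> x) (arcs G) + card (arcs G))"
    by (intro even_num_cycles_comp_permutes permutes_imp_bij[OF zp] permutes_compose[OF xp]
        permutes_inv[OF zp]) simp
  ultimately show ?thesis using num_cycles_rotation_system[OF z x] by simp
qed

text \<open>
  The hypothesis says that the corners which \<open>x\<close> creates join sides of darts that \<open>z\<close>'s faces
  traverse coherently. So an orientation \<open>H\<close> of the faces of \<open>z\<close> is also one of the faces of \<open>x\<close>,
  and on \<open>H\<close> the two face permutations differ by a copy of the even permutation \<open>inv z \<circ> x\<close>.
\<close>

lemma even_card_traced_faces_coherent:
  assumes z: "rotation_system G z" and x: "rotation_system G x"
    and coh: "\<And>a. a \<in> arcs G \<Longrightarrow> orbit (step z) (pos_state (inv z (x a))) = orbit (step z) (pos_state a)"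
  shows "even (card (traced_faces G arev \<sigma> x) + card (traced_faces G arev \<sigma> z))"
proof -
  note zp = rotation_system_permutes[OF z] and xp = rotation_system_permutes[OF x]
  define \<pi> where "\<pi> = inv z \<circ> x"
  have \<pi>p: "\<pi> permutes arcs G" unfolding \<pi>_def by (intro permutes_compose xp permutes_inv zp)
  have z\<pi>: "z (\<pi> a) = x a" for a unfolding \<pi>_def using permutes_inverses(1)[OF zp] by simp
  obtain H where H: "half_system z H" using half_system_exists[OF zp] .
  have sub: "H \<subseteq> states" and rev: "\<And>y. y \<in> states \<Longrightarrow> rev_state y \<in> H \<longleftrightarrow> y \<notin> H"
    using H unfolding half_system_def by blast+
  note bz = bij_betw_step_half_system[OF zp H]
  have finH: "finite H" using finite_subset[OF sub finite_states] .
  have H_orbit: "y' \<in> H \<longleftrightarrow> y \<in> H"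
    if "y \<in> states" "y' \<in> states" "orbit (step z) y' = orbit (step z) y" for y y'
  proof -
    have "y \<in> orbit (step z) y'" "y' \<in> orbit (step z) y"
      using bij_betw_self_in_orbit[OF finite_states bij_betw_step[OF zp]] that by blast+
    then show ?thesis using orbit_subset_bij_betw[OF bz] by blast
  qed
  \<comment> \<open>The darts whose positive state is traversed by the chosen orientation. Coherence
    makes \<open>A\<close> invariant under \<open>\<pi>\<close>.\<close>
  define A where "A = {a \<in> arcs G. pos_state a \<in> H}"
  have \<pi>_arcs: "\<pi> a \<in> arcs G \<longleftrightarrow> a \<in> arcs G" for a using permutes_in_image[OF \<pi>p] .
  have A_\<pi>: "\<pi> a \<in> A \<longleftrightarrow> a \<in> A" if "a \<in> arcs G" for a
  proof -
    have "orbit (step z) (pos_state (\<pi> a)) = orbit (step z) (pos_state a)"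
      using coh[OF that] unfolding \<pi>_def by simp
    then have "pos_state (\<pi> a) \<in> H \<longleftrightarrow> pos_state a \<in> H"
      using H_orbit pos_state_in_states that \<pi>_arcs by blast
    then show ?thesis unfolding A_def using that \<pi>_arcs by blast
  qed
  have A_inv: "inv \<pi> a \<in> A \<longleftrightarrow> a \<in> A" if "a \<in> arcs G" for a
    using A_\<pi>[of "inv \<pi> a"] that permutes_in_image[OF permutes_inv[OF \<pi>p]] permutes_inverses(1)[OF \<pi>p]
    by simp
  \<comment> \<open>\<open>neg_state z a\<close> is the reversal of the successor of
    \<open>pos_state a\<close>, so \<open>H\<close> contains exactly one of the two states of each
    corner.\<close>
  have neg_H: "neg_state z a \<in> H \<longleftrightarrow> a \<notin> A" if a: "a \<in> arcs G" for a
  proof -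
    have za: "z a \<in> arcs G" using a permutes_in_image[OF zp] by simp
    have "rev_state (step z (pos_state a)) = neg_state z a"
      using a by (simp add: step_pos_state face_rev_def neg_state_def)
    then have "neg_state z a \<in> H \<longleftrightarrow> step z (pos_state a) \<notin> H"
      using rev step_in_states[OF zp pos_state_in_states[OF a]] by metis
    moreover have "step z (pos_state a) \<in> H \<longleftrightarrow> pos_state a \<in> H"
      using H_orbit[OF pos_state_in_states[OF a] step_in_states[OF zp pos_state_in_states[OF a]]]
        self_in_orbit_step[OF bij_betw_self_in_orbit[OF finite_states bij_betw_step[OF zp] pos_state_in_states[OF a]]]
      by blast
    ultimately show ?thesis unfolding A_def using a by blast
  qed
  \<comment> \<open>\<open>h\<close> names the state of each corner lying in \<open>H\<close>. On
    negative states the inverse rotation acts, so \<open>\<pi>'\<close> uses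
    \<open>inv \<pi>\<close> there.\<close>
  define h where "h a = (if a \<in> A then pos_state a else neg_state z a)" for a
  define \<pi>' where "\<pi>' a = (if a \<in> A then \<pi> a else inv \<pi> a)" for a
  have h_inj: "inj_on h (arcs G)"
  proof (rule inj_onI)
    fix a b assume ab: "a \<in> arcs G" "b \<in> arcs G" "h a = h b"
    have step_h: "step z (h c) = (if c \<in> A then (z c, 1) else (c, - 1))" if "c \<in> arcs G" for c
      unfolding h_def using that by (simp add: step_pos_state step_neg_state_same[OF zp])
    have "(if a \<in> A then (z a, 1) else (a, - 1)) = (if b \<in> A then (z b, 1) else (b, - 1 :: int))"
      using step_h[OF ab(1)] step_h[OF ab(2)] ab(3) by simp
    then show "a = b" using permutes_inj[OF zp] by (auto split: if_splits dest: injD)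
  qed
  have h_img: "h ` arcs G = H"
  proof (intro equalityI subsetI)
    fix y assume "y \<in> h ` arcs G"
    then show "y \<in> H" using neg_H unfolding h_def A_def by auto
  next
    fix y assume y: "y \<in> H"
    then have "y \<in> states" using sub by blast
    with zp show "y \<in> h ` arcs G"
    proof (cases rule: states_cases)
      case (1 a)
      then have "y = h a" using y unfolding h_def A_def by simp
      then show ?thesis using 1 by blast
    next
      case (2 a)
      then have "y = h a" using y neg_H[of a] unfolding h_def by simp
      then show ?thesis using 2 by blast
    qed
  qed
  have \<pi>'_bij: "bij_betw \<pi>' (arcs G) (arcs G)"
  proof -
    have "inj_on \<pi>' (arcs G)"
    proof (rule inj_onI)
      fix a b assume ab: "a \<in> arcs G" "b \<in> arcs G" "\<pi>' a = \<pi>' b"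
      have "\<pi>' c \<in> A \<longleftrightarrow> c \<in> A" if "c \<in> arcs G" for c
        unfolding \<pi>'_def using A_\<pi>[OF that] A_inv[OF that] by simp
      then have "a \<in> A \<longleftrightarrow> b \<in> A" using ab by metis
      with ab(3) show "a = b"
        unfolding \<pi>'_def using permutes_inj[OF \<pi>p] permutes_inj[OF permutes_inv[OF \<pi>p]]
        by (auto split: if_splits dest: injD)
    qed
    moreover have "\<pi>' ` arcs G \<subseteq> arcs G"
      unfolding \<pi>'_def using \<pi>_arcs permutes_in_image[OF permutes_inv[OF \<pi>p]] by auto
    ultimately show ?thesis unfolding bij_betw_def using endo_inj_surj[OF finite_arcs] by blast
  qed
  \<comment> \<open>A permutation of a finite set and its inverse have the same orbits, so
    \<open>\<pi>'\<close> inherits the parity of \<open>\<pi>\<close>.\<close>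
  have orb_\<pi>': "orbit \<pi>' a = orbit \<pi> a" if a: "a \<in> arcs G" for a
  proof (cases "a \<in> A")
    case True
    show ?thesis
    proof (rule orbit_cong0[OF True])
      show "\<pi>' \<in> A \<rightarrow> A" unfolding \<pi>'_def using A_\<pi> by (auto simp: A_def)
    qed (simp add: \<pi>'_def)
  next
    case False
    have "orbit \<pi>' a = orbit (inv \<pi>) a"
    proof (rule orbit_cong0)
      show "a \<in> arcs G - A" using a False by blast
      show "\<pi>' \<in> arcs G - A \<rightarrow> arcs G - A"
        unfolding \<pi>'_def using A_inv permutes_in_image[OF permutes_inv[OF \<pi>p]] by auto
    qed (simp add: \<pi>'_def)
    also have "\<dots> = orbit \<pi> a"
      using \<pi>p finite_arcs by (intro orbit_inv_eq) (unfold permutation_permutes, blast)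
    finally show ?thesis .
  qed
  have step_x: "step x (h a) = step z (h (\<pi>' a))" if a: "a \<in> arcs G" for a
  proof (cases "a \<in> A")
    case True
    then have "\<pi> a \<in> A" using A_\<pi>[OF a] by blast
    then show ?thesis
      using True a \<pi>_arcs z\<pi> by (simp add: h_def \<pi>'_def step_pos_state)
  next
    case False
    then have notin: "inv \<pi> a \<notin> A" using A_inv[OF a] by blast
    have inv_arcs: "inv \<pi> a \<in> arcs G" using permutes_in_image[OF permutes_inv[OF \<pi>p]] a by blast
    have "x (inv \<pi> a) = z a" using z\<pi>[of "inv \<pi> a"] permutes_inverses(1)[OF \<pi>p] by simp
    then have "inv x (z a) = inv \<pi> a" using permutes_inverses(2)[OF xp] by metis
    then show ?thesis
      using False notin a inv_arcs permutes_in_image[OF zp]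
      by (simp add: h_def \<pi>'_def step_neg_state permutes_inverses(2)[OF zp])
  qed
  \<comment> \<open>\<open>\<pi>'\<close> transported to \<open>H\<close>; there the face step of
    \<open>x\<close> is that of \<open>z\<close> preceded by \<open>\<Psi>\<close>.\<close>
  define \<Psi> where "\<Psi> = h \<circ> \<pi>' \<circ> inv_into (arcs G) h"
  have bh: "bij_betw h (arcs G) H" unfolding bij_betw_def using h_inj h_img by blast
  have \<Psi>_h: "\<Psi> (h a) = h (\<pi>' a)" if "a \<in> arcs G" for a
    unfolding \<Psi>_def using inv_into_f_f[OF h_inj that] by simp
  have \<Psi>_bij: "bij_betw \<Psi> H H"
    unfolding \<Psi>_def by (intro bij_betw_trans[OF bij_betw_inv_into[OF bh] bij_betw_trans[OF \<pi>'_bij bh], unfolded comp_assoc[symmetric]])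
  have step_x_\<Psi>: "step x y = (step z \<circ> \<Psi>) y" if y: "y \<in> H" for y
  proof -
    obtain a where "a \<in> arcs G" "y = h a" using y h_img by blast
    then show ?thesis using step_x \<Psi>_h by simp
  qed
  \<comment> \<open>Only closure under the step depends on the rotation.\<close>
  have "half_system x H"
  proof -
    have "step x y \<in> H" if "y \<in> H" for y
      using step_x_\<Psi>[OF that] bij_betw_apply[OF bij_betw_trans[OF \<Psi>_bij bz] that] by simp
    with sub rev show ?thesis unfolding half_system_def by (intro conjI ballI)
  qed
  then have "card (traced_faces G arev \<sigma> x) = num_cycles (step x) H"
    by (rule card_traced_faces_half_system[OF xp])
  also have "\<dots> = num_cycles (step z \<circ> \<Psi>) H"
    by (rule num_cycles_cong[OF bij_betw_trans[OF \<Psi>_bij bz] step_x_\<Psi>])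
  finally have cx: "card (traced_faces G arev \<sigma> x) = num_cycles (step z \<circ> \<Psi>) H" .
  have "num_cycles \<Psi> H = num_cycles \<pi>' (arcs G)"
    using num_cycles_conj[OF finite_arcs \<pi>'_bij h_inj \<Psi>_h] h_img by simp
  also have "orbit \<pi>' ` arcs G = orbit \<pi> ` arcs G" by (rule image_cong[OF refl orb_\<pi>'])
  then have "num_cycles \<pi>' (arcs G) = num_cycles \<pi> (arcs G)" unfolding num_cycles_def by (simp only:)
  finally have "num_cycles \<Psi> H = num_cycles \<pi> (arcs G)" .
  moreover have "card H = card (arcs G)" using bij_betw_same_card[OF bh] by simp
  ultimately have "even (num_cycles \<Psi> H + card H)"
    using even_num_cycles_rotation_quotient[OF z x] unfolding \<pi>_def by simp
  with even_num_cycles_comp[OF finH bz \<Psi>_bij]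
  show ?thesis unfolding cx card_traced_faces_half_system[OF zp H] by presburger
qed

section \<open>Gaps in the spectrum\<close>

lemma euler_genus_diff:
  "euler_genus G arev \<sigma> rot - euler_genus G arev \<sigma> rot'
    = int (card (traced_faces G arev \<sigma> rot')) - int (card (traced_faces G arev \<sigma> rot))"
  unfolding euler_genus_def num_faces_def by simp

text \<open>
  Among the embeddings above the gap, take \<open>z\<close> agreeing with \<open>x\<close> on as many darts as possible.
  Every block swap moving \<open>z\<close> closer to \<open>x\<close> has to jump over the gap, so it creates two faces,
  and therefore all the corners at which \<open>z\<close> and \<open>x\<close> differ are coherent in \<open>z\<close>.
\<close>

lemma parity_below_gap:
  assumes gap: "g \<notin> euler_genus_spectrum G arev \<sigma>"
    and w: "rotation_system G w" "g < euler_genus G arev \<sigma> w"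
    and x: "rotation_system G x" "euler_genus G arev \<sigma> x < g"
  shows "odd (g - euler_genus G arev \<sigma> x)"
proof -
  let ?eg = "euler_genus G arev \<sigma>"
  let ?above = "\<lambda>rot. rotation_system G rot \<and> g < ?eg rot"
  define D where "D rot = card {e \<in> arcs G. rot e \<noteq> x e}" for rot
  obtain z where z: "?above z" and min: "\<And>rot. ?above rot \<Longrightarrow> D z \<le> D rot"
    using ex_has_least_nat[of ?above w D] w by blast
  have zr: "rotation_system G z" using z by blast
  note zp = rotation_system_permutes[OF zr] and xp = rotation_system_permutes[OF x(1)]
  have swap: "?eg z = g + 1 \<and>
      orbit (step z) (pos_state (inv z (x a))) = orbit (step z) (pos_state a)"
    if a: "a \<in> arcs G" "z a \<noteq> x a" for a
  proof -
    obtain p q where pq: "p \<in> arcs G" "q \<in> arcs G" "p = inv z (x a)"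
      and rot: "rotation_system G (z \<circ> transpose a p \<circ> transpose p q)"
      and closer: "D (z \<circ> transpose a p \<circ> transpose p q) < D z"
      using rotation_system_closer[OF zr x(1) a] unfolding D_def by blast
    let ?z = "z \<circ> transpose a p \<circ> transpose p q"
    have "\<not> g < ?eg ?z" using min[of ?z] rot closer by (meson not_le)
    moreover have "?eg ?z \<noteq> g" using gap rot unfolding euler_genus_spectrum_def by blast
    ultimately have "?eg ?z < g" by simp
    moreover note card_traced_faces_block_swap(1)[OF zp a(1) pq(1,2)]
    moreover have "?eg z - ?eg ?z = int (card (traced_faces G arev \<sigma> ?z)) - int (card (traced_faces G arev \<sigma> z))"
      by (rule euler_genus_diff)
    \<comment> \<open>The swap falls from at least \<open>g + 1\<close> to at most
      \<open>g - 1\<close> but can gain at most two faces, so both bounds are attained.\<close>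
    ultimately have "?eg z = g + 1" and
      "card (traced_faces G arev \<sigma> ?z) = card (traced_faces G arev \<sigma> z) + 2"
      using z by linarith+
    with card_traced_faces_block_swap(2)[OF zp a(1) pq(1,2)] pq(3) show ?thesis by simp
  qed
  \<comment> \<open>\<open>z\<close> and \<open>x\<close> lie on opposite sides of \<open>g\<close>,
    hence differ, and both fix everything that is not a dart.\<close>
  have "\<exists>a \<in> arcs G. z a \<noteq> x a"
  proof (rule ccontr)
    assume "\<not> ?thesis"
    then have "z = x" using permutes_not_in[OF zp] permutes_not_in[OF xp] by (intro ext) metis
    with z x(2) show False by simp
  qed
  then have gz: "?eg z = g + 1" using swap by blast
  have "orbit (step z) (pos_state (inv z (x a))) = orbit (step z) (pos_state a)" if "a \<in> arcs G" for a
  proof (cases "z a = x a")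
    case True
    then have "inv z (x a) = a" using permutes_inverses(2)[OF zp] by metis
    then show ?thesis by simp
  qed (use swap that in blast)
  then have "even (card (traced_faces G arev \<sigma> x) + card (traced_faces G arev \<sigma> z))"
    by (rule even_card_traced_faces_coherent[OF zr x(1)])
  then have "even (int (card (traced_faces G arev \<sigma> x)) - int (card (traced_faces G arev \<sigma> z)))"
    by simp
  then have "even (?eg z - ?eg x)" using euler_genus_diff[of z x] by simp
  then show ?thesis unfolding gz by presburger
qed

lemma finite_euler_genus_spectrum: "finite (euler_genus_spectrum G arev \<sigma>)"
proof -
  have "euler_genus_spectrum G arev \<sigma> \<subseteq> euler_genus G arev \<sigma> ` {rot. rot permutes arcs G}"
    unfolding euler_genus_spectrum_def using rotation_system_permutes by blast
  then show ?thesis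
    using finite_permutations[OF finite_arcs] finite_subset by blast
qed

end

theorem mainTheorem4:
  fixes G :: "('v, 'a) pre_digraph" and arev :: "'a \<Rightarrow> 'a" and \<sigma> :: "'a \<Rightarrow> int" and k :: int
  assumes "signed_graph G arev \<sigma>"
    and "connected G"
    and "k \<in> euler_genus_spectrum G arev \<sigma>"
    and "k + 1 \<in> euler_genus_spectrum G arev \<sigma>"
  shows "{k..max_euler_genus G arev \<sigma>} \<subseteq> euler_genus_spectrum G arev \<sigma>"
proof
  interpret signed_graph G arev \<sigma> by (rule assms(1))
  let ?S = "euler_genus_spectrum G arev \<sigma>"
  fix g assume g: "g \<in> {k..max_euler_genus G arev \<sigma>}"
  show "g \<in> ?S"
  proof (rule ccontr)
    assume gap: "g \<notin> ?S"
    \<comment> \<open>The spectrum is finite and nonempty, so its maximum is attained by an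
      embedding above the gap.\<close>
    have max: "max_euler_genus G arev \<sigma> \<in> ?S"
      unfolding max_euler_genus_def using assms(3) finite_euler_genus_spectrum by (intro Max_in) auto
    then have "g \<noteq> max_euler_genus G arev \<sigma>" using gap by blast
    then have "g < max_euler_genus G arev \<sigma>" using g by simp
    with max obtain w where w: "rotation_system G w" "g < euler_genus G arev \<sigma> w"
      unfolding euler_genus_spectrum_def by auto
    obtain x where x: "rotation_system G x" "euler_genus G arev \<sigma> x = k"
      using assms(3) unfolding euler_genus_spectrum_def by auto
    obtain y where y: "rotation_system G y" "euler_genus G arev \<sigma> y = k + 1"
      using assms(4) unfolding euler_genus_spectrum_def by auto
    have "g \<noteq> k" "g \<noteq> k + 1" using gap assms(3,4) by blast+
    then have lt: "k < g" "k + 1 < g" using g by auto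
    \<comment> \<open>Embeddings of genus \<open>k\<close> and \<open>k + 1\<close> both lie below
      the gap, yet have different parities.\<close>
    have "odd (g - k)" using parity_below_gap[OF gap w x(1)] x(2) lt(1) by simp
    moreover have "odd (g - (k + 1))" using parity_below_gap[OF gap w y(1)] y(2) lt(2) by simp
    ultimately show False by presburger
  qed
qed

end
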